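(* Let $S$ be a synset (a finite set of word vectors in $\mathbb{R}^N$) and assume $|S|>2$. Let $v\in S$. Then $v\in \mathrm{Int}\,S$ if and only if the rank of $v$ is maximal in the given synset $S$ and equals the Stirling number of the second kind for partition of $S$ into two nonempty subsets, i.e. $$v\in \mathrm{Int}\,S \iff \mathrm{rank}(v)=2^{|S|-2}-1,\qquad \text{where } |S|\geq 3.$$
   Context: Words are represented by vectors in $\mathbb{R}^N$, and a synset is a finite set $S=\{v_k,\ k=1,\dots,|S|\}$ of such vectors. For vectors $a_1,\dots,a_n\in\mathbb{R}^N$ put $M((a_i),n)=\frac{\sum_{i=1}^n a_i}{\|\sum_{i=1}^n a_i\|}$. For sets $A=\{a_1,\dots,a_n\}$ and $B=\{b_1,\dots,b_m\}$ of vectors in $\mathbb{R}^N$ define $\mathrm{sim}\{A,B\}=(M((a_i),n),M((b_j),m))$, where $(\cdot,\cdot)$ is the inner product and $\|\cdot\|$ the norm. For $v\in S$, let $P_v=\{p_i,\ i=1,\dots,2^{|S|-2}-1\}$ be the set of all partitions, enumerated in some way, of $S\setminus\{v\}$ into two disjoint nonempty subsets, $S\setminus\{v\}=S_1\sqcup S_2$, $S_1\neq\varnothing$, $S_2\neq\varnothing$. Interior: $\mathrm{Int}\,S$ is the set of all $v\in S$ such that $\mathrm{sim}\{S_1,S_2\}<\mathrm{sim}\{S_1\cup\{v\},S_2\}$ and $\mathrm{sim}\{S_1,S_2\}<\mathrm{sim}\{S_1,S_2\cup\{v\}\}$ for all partitions $S\setminus\{v\}=S_1\sqcup S_2$ into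 two nonempty subsets. Rank: for a partition $p_i\in P_v$, $S\setminus\{v\}=S_1\sqcup S_2$, write $\mathrm{sim}_i=\mathrm{sim}\{S_1,S_2\}$, $\mathrm{sim}^1_i=\mathrm{sim}\{S_1\cup\{v\},S_2\}$, $\mathrm{sim}^2_i=\mathrm{sim}\{S_1,S_2\cup\{v\}\}$. The function $r_v:P_v\to\{-1,0,1\}$ is given by $r_v(p_i)=-1$ if $\mathrm{sim}^1_i<\mathrm{sim}_i$ and $\mathrm{sim}^2_i<\mathrm{sim}_i$; $r_v(p_i)=1$ if $\mathrm{sim}^1_i>\mathrm{sim}_i$ and $\mathrm{sim}^2_i>\mathrm{sim}_i$; $r_v(p_i)=0$ if $(\mathrm{sim}^1_i-\mathrm{sim}_i)\cdot(\mathrm{sim}^2_i-\mathrm{sim}_i)<0$. The rank of $v\in S$, where $|S|>2$, is the integer $\mathrm{rank}(v)=\sum_{i=1}^{|P_v|} r_v(p_i)$. Stirling number of the second kind: $\left\{{n\atop k}\right\}$, where $n$ is the number of elements in the set and $k$ is the number of (nonempty) subsets in a partition; the Stirling number meant in the claim is written $\left\{{n\atop k}\right\}=\left\{{|S|\atop 2}\right\}$, with $k=2$.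
   Formalization: The Stirling number is taken for partitions of S∖{v} (n=|S|-1), since the stated {|S| over 2}=2^(|S|-1)-1 contradicts the displayed 2^(|S|-2)-1 (for |S|=3: 3 versus 1); r_v, left undefined when a difference of similarities vanishes, is set to 0 there. *)

theory Defs
  imports "HOL-Analysis.Analysis" "HOL-Library.Disjoint_Sets" "HOL-Combinatorics.Stirling"
begin

(* If the vectors of A sum to 0, division by zero gives unit_sum A = 0. *)
definition unit_sum :: "(real ^ 'n) set \<Rightarrow> real ^ 'n" where
  "unit_sum A = (\<Sum>a\<in>A. a) /\<^sub>R norm (\<Sum>a\<in>A. a)"

definition sim :: "(real ^ 'n) set \<Rightarrow> (real ^ 'n) set \<Rightarrow> real" where
  "sim A B = unit_sum A \<bullet> unit_sum B"

definition Int_synset :: "(real ^ 'n) set \<Rightarrow> (real ^ 'n) set" where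
  "Int_synset S = {v \<in> S. \<forall>S1 S2. S1 \<noteq> {} \<and> S2 \<noteq> {} \<and> S1 \<inter> S2 = {} \<and> S1 \<union> S2 = S - {v} \<longrightarrow>
     sim S1 S2 < sim (S1 \<union> {v}) S2 \<and> sim S1 S2 < sim S1 (S2 \<union> {v})}"

(* Partitions are unordered: {S1, S2} and {S2, S1} count once. *)
definition two_partitions :: "(real ^ 'n) set \<Rightarrow> real ^ 'n \<Rightarrow> (real ^ 'n) set set set" where
  "two_partitions S v = {p. partition_on (S - {v}) p \<and> card p = 2}"

(* The value is 0 when the two differences have opposite signs, and also, by convention,
   in the degenerate case where at least one of them vanishes. *)
definition r_pair :: "real ^ 'n \<Rightarrow> (real ^ 'n) set \<Rightarrow> (real ^ 'n) set \<Rightarrow> int" where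
  "r_pair v S1 S2 =
     (if sim (S1 \<union> {v}) S2 < sim S1 S2 \<and> sim S1 (S2 \<union> {v}) < sim S1 S2 then - 1
      else if sim (S1 \<union> {v}) S2 > sim S1 S2 \<and> sim S1 (S2 \<union> {v}) > sim S1 S2 then 1
      else 0)"

definition r_part :: "real ^ 'n \<Rightarrow> (real ^ 'n) set set \<Rightarrow> int" where
  "r_part v p = (THE k. \<exists>S1 S2. p = {S1, S2} \<and> k = r_pair v S1 S2)"

definition rank_synset :: "(real ^ 'n) set \<Rightarrow> real ^ 'n \<Rightarrow> int" where
  "rank_synset S v = (\<Sum>p\<in>two_partitions S v. r_part v p)"

lemma sim_commute: "sim A B = sim B A"
  by (simp add: sim_def inner_commute)

lemma r_pair_commute: "r_pair v S1 S2 = r_pair v S2 S1"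
proof -
  have "sim S1 S2 = sim S2 S1" "sim (S1 \<union> {v}) S2 = sim S2 (S1 \<union> {v})"
    "sim S1 (S2 \<union> {v}) = sim (S2 \<union> {v}) S1"
    by (rule sim_commute)+
  then show ?thesis
    unfolding r_pair_def by presburger
qed

lemma r_part_eq: "r_part v {S1, S2} = r_pair v S1 S2"
  unfolding r_part_def
proof (rule the_equality)
  show "\<exists>T1 T2. {S1, S2} = {T1, T2} \<and> r_pair v S1 S2 = r_pair v T1 T2"
    by blast
next
  fix k assume "\<exists>T1 T2. {S1, S2} = {T1, T2} \<and> k = r_pair v T1 T2"
  then obtain T1 T2 where "{S1, S2} = {T1, T2}" and k: "k = r_pair v T1 T2"
    by blast
  then consider "T1 = S1" "T2 = S2" | "T1 = S2" "T2 = S1"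
    unfolding doubleton_eq_iff by blast
  then show "k = r_pair v S1 S2"
    by cases (simp_all only: k r_pair_commute[of v S2 S1])
qed

lemma two_partitions_iff:
  "p \<in> two_partitions S v \<longleftrightarrow>
     (\<exists>S1 S2. p = {S1, S2} \<and> S1 \<noteq> {} \<and> S2 \<noteq> {} \<and> S1 \<inter> S2 = {} \<and> S1 \<union> S2 = S - {v})"
proof
  assume "p \<in> two_partitions S v"
  then have P: "partition_on (S - {v}) p" and "card p = 2"
    by (auto simp: two_partitions_def)
  then obtain S1 S2 where p: "p = {S1, S2}" "S1 \<noteq> S2"
    by (auto simp: card_2_iff)
  then show "\<exists>S1 S2. p = {S1, S2} \<and> S1 \<noteq> {} \<and> S2 \<noteq> {} \<and> S1 \<inter> S2 = {} \<and> S1 \<union> S2 = S - {v}"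
  proof (intro exI conjI)
    show "p = {S1, S2}" by (rule p)
    show "S1 \<noteq> {}" "S2 \<noteq> {}" using partition_onD3[OF P] p(1) by auto
    show "S1 \<inter> S2 = {}" using disjointD[OF partition_onD2[OF P]] p by simp
    show "S1 \<union> S2 = S - {v}" using partition_onD1[OF P] p(1) by simp
  qed
next
  assume "\<exists>S1 S2. p = {S1, S2} \<and> S1 \<noteq> {} \<and> S2 \<noteq> {} \<and> S1 \<inter> S2 = {} \<and> S1 \<union> S2 = S - {v}"
  then obtain S1 S2 where p: "p = {S1, S2}" "S1 \<noteq> {}" "S2 \<noteq> {}" "S1 \<inter> S2 = {}"
    "S1 \<union> S2 = S - {v}" by blast
  have ne: "S1 \<noteq> S2" using p(2,4) by blast
  have "partition_on (S - {v}) p"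
  proof (rule partition_onI)
    show "\<Union> p = S - {v}" using p(1,5) by simp
    show "{} \<notin> p" using p(1-3) by blast
    show "disjnt q q'" if "q \<in> p" "q' \<in> p" "q \<noteq> q'" for q q'
    proof -
      have "q = S1 \<and> q' = S2 \<or> q = S2 \<and> q' = S1"
        using that unfolding p(1) by blast
      then show ?thesis using p(4) unfolding disjnt_def by blast
    qed
  qed
  moreover have "card p = 2" using ne by (simp add: p(1))
  ultimately show "p \<in> two_partitions S v"
    by (simp add: two_partitions_def)
qed

end

theory Submission
  imports Defs
begin

text \<open>Every partition value is at most 1, so the rank is at most the number of two-block partitions of
  \<open>S - {v}\<close>, with equality iff every partition has value 1, which is the definition of an interior
  point. This number is \<open>2 ^ (card S - 2) - 1\<close>: after fixing \<open>a\<close>, a partition is determined by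
  its block not containing \<open>a\<close>, an arbitrary nonempty set avoiding \<open>a\<close>. It depends only on
  \<open>card S\<close>, so it also bounds the ranks of all other elements.\<close>

lemma bij_betw_two_partitions:
  assumes a: "a \<in> S - {v}"
  shows "bij_betw (\<lambda>B. {B, S - {v} - B}) (Pow (S - {v} - {a}) - {{}}) (two_partitions S v)"
  unfolding bij_betw_def
proof
  show "inj_on (\<lambda>B. {B, S - {v} - B}) (Pow (S - {v} - {a}) - {{}})"
  proof (rule inj_onI)
    fix B C
    assume "B \<in> Pow (S - {v} - {a}) - {{}}" "C \<in> Pow (S - {v} - {a}) - {{}}"
      and eq: "{B, S - {v} - B} = {C, S - {v} - C}"
    \<comment> \<open>Equal unordered pairs agree either directly or after a swap; \<open>a\<close>
      rules out the swap, since it lies in the complement of \<open>C\<close> but not in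
      \<open>B\<close>.\<close>
    then have "a \<notin> B" "a \<in> S - {v} - C" using a by auto
    then have "B \<noteq> S - {v} - C" by blast
    with eq show "B = C" by (simp add: doubleton_eq_iff)
  qed
  show "(\<lambda>B. {B, S - {v} - B}) ` (Pow (S - {v} - {a}) - {{}}) = two_partitions S v"
  proof
    show "(\<lambda>B. {B, S - {v} - B}) ` (Pow (S - {v} - {a}) - {{}}) \<subseteq> two_partitions S v"
    proof
      fix p assume "p \<in> (\<lambda>B. {B, S - {v} - B}) ` (Pow (S - {v} - {a}) - {{}})"
      then obtain B where p: "p = {B, S - {v} - B}" and B: "B \<subseteq> S - {v} - {a}" "B \<noteq> {}"
        by auto
      have "S - {v} - B \<noteq> {}" "B \<inter> (S - {v} - B) = {}" "B \<union> (S - {v} - B) = S - {v}"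
        using a B by blast+
      with p B show "p \<in> two_partitions S v"
        unfolding two_partitions_iff by (metis (no_types))
    qed
    show "two_partitions S v \<subseteq> (\<lambda>B. {B, S - {v} - B}) ` (Pow (S - {v} - {a}) - {{}})"
    proof
      fix p assume "p \<in> two_partitions S v"
      then obtain S1 S2 where p: "p = {S1, S2}" and ne: "S1 \<noteq> {}" "S2 \<noteq> {}"
        and S12: "S1 \<inter> S2 = {}" "S1 \<union> S2 = S - {v}"
        unfolding two_partitions_iff by blast
      have S1: "S1 = S - {v} - S2" and S2: "S2 = S - {v} - S1" using S12 by blast+
      show "p \<in> (\<lambda>B. {B, S - {v} - B}) ` (Pow (S - {v} - {a}) - {{}})"
      \<comment> \<open>The preimage is whichever of the two blocks misses \<open>a\<close>.\<close>
      proof (cases "a \<in> S1")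
        case True
        then have "S2 \<in> Pow (S - {v} - {a}) - {{}}" using ne S12 by blast
        moreover have "p = {S2, S - {v} - S2}" using p S1 by (simp add: insert_commute)
        ultimately show ?thesis by (rule rev_image_eqI)
      next
        case False
        then have "S1 \<in> Pow (S - {v} - {a}) - {{}}" using ne S12 by blast
        moreover have "p = {S1, S - {v} - S1}" using p S2 by simp
        ultimately show ?thesis by (rule rev_image_eqI)
      qed
    qed
  qed
qed

lemma card_two_partitions:
  assumes "finite S" "v \<in> S" "card S \<ge> 2"
  shows "card (two_partitions S v) = 2 ^ (card S - 2) - 1"
proof -
  \<comment> \<open>The marker \<open>a\<close> is any second element of \<open>S\<close>. If it is
    the only one, there are no partitions and the formula gives 0.\<close>
  have "card (S - {v}) \<noteq> 0" using assms by simp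
  then have "S - {v} \<noteq> {}" by force
  then obtain a where a: "a \<in> S - {v}" by blast
  then have "card (S - {v} - {a}) = card S - 2" using assms by simp
  moreover have "card (two_partitions S v) = card (Pow (S - {v} - {a}) - {{}})"
    using bij_betw_same_card[OF bij_betw_two_partitions[OF a]] by simp
  ultimately show ?thesis
    using assms(1) by (simp add: card_Diff_singleton card_Pow)
qed

lemma finite_two_partitions: "finite S \<Longrightarrow> finite (two_partitions S v)"
  by (rule finite_subset[of _ "Pow (Pow S)"]) (auto simp: two_partitions_def partition_on_def)

lemma r_part_le_1:
  assumes "p \<in> two_partitions S v"
  shows "r_part v p \<le> 1"
proof -
  obtain S1 S2 where "p = {S1, S2}" using assms unfolding two_partitions_iff by blast
  then have "r_part v p = r_pair v S1 S2" by (simp only: r_part_eq)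
  then show ?thesis by (simp only: r_pair_def split: if_split) simp
qed

text \<open>The deficits \<open>1 - f x\<close> are nonnegative, so their sum vanishes only if each
  of them does.\<close>

lemma sum_eq_card_iff:
  fixes f :: "'a \<Rightarrow> int"
  assumes "finite A" "\<And>x. x \<in> A \<Longrightarrow> f x \<le> 1"
  shows "sum f A = int (card A) \<longleftrightarrow> (\<forall>x\<in>A. f x = 1)"
proof -
  have "sum f A = int (card A) \<longleftrightarrow> (\<Sum>x\<in>A. 1 - f x) = 0"
    by (auto simp: sum_subtractf)
  also have "\<dots> \<longleftrightarrow> (\<forall>x\<in>A. 1 - f x = 0)"
    using assms by (intro sum_nonneg_eq_0_iff) auto
  finally show ?thesis by auto
qed

lemma rank_synset_le:
  "finite S \<Longrightarrow> rank_synset S v \<le> int (card (two_partitions S v))"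
  unfolding rank_synset_def
  using sum_bounded_above[of "two_partitions S v" "r_part v" 1] r_part_le_1 by fastforce

text \<open>The conditions for -1 and 1 exclude each other, so the order of the branches does not
  matter. Read from right to left, this rewrites the inequalities in
  \<open>Int_synset\<close>.\<close>

lemma r_pair_eq_1_iff:
  "r_pair v S1 S2 = 1 \<longleftrightarrow> sim S1 S2 < sim (S1 \<union> {v}) S2 \<and> sim S1 S2 < sim S1 (S2 \<union> {v})"
  by (auto simp: r_pair_def)

text \<open>Bridges the ordered pairs in \<open>Int_synset\<close> and the unordered partitions in
  the rank; \<open>r_part_eq\<close> makes the choice of order harmless.\<close>

lemma Int_synset_iff_r_part:
  assumes "v \<in> S"
  shows "v \<in> Int_synset S \<longleftrightarrow> (\<forall>p\<in>two_partitions S v. r_part v p = 1)"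
proof
  assume v: "v \<in> Int_synset S"
  show "\<forall>p\<in>two_partitions S v. r_part v p = 1"
  proof
    fix p assume "p \<in> two_partitions S v"
    then obtain S1 S2 where p: "p = {S1, S2}"
      and "S1 \<noteq> {} \<and> S2 \<noteq> {} \<and> S1 \<inter> S2 = {} \<and> S1 \<union> S2 = S - {v}"
      unfolding two_partitions_iff by blast
    then have "r_pair v S1 S2 = 1"
      using v unfolding Int_synset_def r_pair_eq_1_iff[symmetric] by blast
    then show "r_part v p = 1" by (simp only: p r_part_eq)
  qed
next
  assume r: "\<forall>p\<in>two_partitions S v. r_part v p = 1"
  have "r_pair v S1 S2 = 1"
    if "S1 \<noteq> {} \<and> S2 \<noteq> {} \<and> S1 \<inter> S2 = {} \<and> S1 \<union> S2 = S - {v}" for S1 S2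
  proof -
    have "{S1, S2} \<in> two_partitions S v" unfolding two_partitions_iff using that by blast
    with r show ?thesis by (metis r_part_eq)
  qed
  with assms show "v \<in> Int_synset S"
    unfolding Int_synset_def r_pair_eq_1_iff[symmetric] by blast
qed

theorem mainTheorem1:
  fixes S :: "(real ^ 'n) set" and v :: "real ^ 'n"
  assumes "finite S" and "card S > 2" and "v \<in> S"
  shows "(v \<in> Int_synset S \<longleftrightarrow>
            (\<forall>w\<in>S. rank_synset S w \<le> rank_synset S v) \<and>
            rank_synset S v = int (Stirling (card (S - {v})) 2)) \<and>
         (v \<in> Int_synset S \<longleftrightarrow> rank_synset S v = 2 ^ (card S - 2) - 1)"
proof -
  have card: "int (card (two_partitions S w)) = 2 ^ (card S - 2) - 1" if "w \<in> S" for w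
    using card_two_partitions[OF assms(1) that] assms(2) by (simp add: of_nat_diff)
  \<comment> \<open>Successor form for \<open>Stirling_2\<close>, which evaluates the Stirling
    number at \<open>Suc n\<close> and 2 as \<open>2 ^ n - 1\<close>.\<close>
  have "card (S - {v}) = Suc (card S - 2)" using assms by simp
  then have Stirling: "int (Stirling (card (S - {v})) 2) = 2 ^ (card S - 2) - 1"
    using Stirling_2[of "card S - 2"] by (simp add: of_nat_diff flip: numeral_2_eq_2)
  have Int: "v \<in> Int_synset S \<longleftrightarrow> rank_synset S v = 2 ^ (card S - 2) - 1"
    unfolding Int_synset_iff_r_part[OF assms(3)] card[OF assms(3), symmetric] rank_synset_def
    using sum_eq_card_iff[of "two_partitions S v" "r_part v"]
      finite_two_partitions[OF assms(1)] r_part_le_1 by blast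
  \<comment> \<open>The bound is the same for every \<open>w\<close> in \<open>S\<close>, so
    attaining it at \<open>v\<close> already makes the rank of \<open>v\<close> maximal.\<close>
  have "rank_synset S w \<le> 2 ^ (card S - 2) - 1" if "w \<in> S" for w
    using rank_synset_le[OF assms(1), of w] card[OF that] by simp
  then show ?thesis unfolding Stirling using Int by auto
qed

end
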